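(* Let $\sigma>0$, $\Delta>0$, $\kappa_0\ge1$, and let $\mathcal A(\Delta,\kappa_0)$ be the class of diagonalisable matrices $A\in\mathbb C^{N\times N}$ with simple spectrum whose eigenvalues are pairwise separated by at least $\Delta$ and which have an eigenvector matrix $V$ with $\kappa_2(V)\le\kappa_0$. Let $g_1:=\mathbb E_\mu|\psi_1(x)|^2$. Consider $M$ observations from $$y_i=A\,\Psi(x_i)+B\,u_i+e_i,\qquad e_i\sim\mathcal N(0,\sigma^2I_N),\quad i=1,\dots,M.$$ Then for every $M$ with $\sigma/\sqrt{2g_1M}\le\Delta/2$, $$\inf_{\hat A}\ \sup_{A\in\mathcal A(\Delta,\kappa_0)}\ \mathbb E\Bigl[\min_\pi\max_k\bigl|\lambda_k(\hat A)-\lambda_{\pi(k)}(A)\bigr|\Bigr]\ \ge\ \frac{\sigma}{8\sqrt{g_1M}},$$ where the infimum runs over all measurable estimators $\hat A$ and the minimum over permutations $\pi$ of $\{1,\dots,N\}$.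
   Context: $\Psi=(\psi_1,\dots,\psi_N)^\top:\mathcal X\to\mathbb C^N$ is a dictionary of functions $\psi_i\in L^2(\mathcal X,\mu)$ on a state space $\mathcal X\subseteq\mathbb R^d$ with probability measure $\mu$; controls $u$ take values in $\mathcal U\subseteq\mathbb R^p$ with law $\nu$. The design points $(x_i,u_i)$ are i.i.d. from $\mu\otimes\nu$, the noise vectors $e_i$ are i.i.d. and independent of the design, and $B\in\mathbb C^{N\times p}$ is a fixed matrix. An estimator $\hat A$ is a measurable $\mathbb C^{N\times N}$-valued function of the observed data $(x_i,u_i,y_i)_{i=1}^M$. $\kappa_2(V)=\|V\|_2\|V^{-1}\|_2$. Eigenvalues $\lambda_k(\cdot)$ are counted with algebraic multiplicity. *)

theory Defs
  imports
    "HOL-Analysis.Analysis"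
    "HOL-Probability.Probability"
    "HOL-Computational_Algebra.Computational_Algebra"
begin

definition charpoly :: "complex^'n^'n \<Rightarrow> complex poly" where
  "charpoly A = det (\<chi> i j. if i = j then [:- A $ i $ j, 1:] else [:- A $ i $ j:])"

text \<open>The eigenvalues, listed with algebraic multiplicity in some fixed but unspecified order;
  the lemma \<open>charpoly_eigval\<close> below shows that such a list always exists.\<close>

definition eigval :: "complex^'n^'n \<Rightarrow> 'n \<Rightarrow> complex" where
  "eigval A = (SOME l. charpoly A = (\<Prod>k\<in>UNIV. [:- l k, 1:]))"

lemma charpoly_monic:
  fixes A :: "complex^'n^'n"
  shows "degree (charpoly A) = CARD('n)" "lead_coeff (charpoly A) = 1"
proof -
  define C :: "complex poly^'n^'n"
    where "C = (\<chi> i j. if i = j then [:- A $ i $ j, 1:] else [:- A $ i $ j:])"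
  define t where "t = (\<lambda>p. of_int (sign p) * (\<Prod>i\<in>UNIV. C $ i $ p i))"
  define S where "S = {p. p permutes (UNIV :: 'n set)}"
  have fS: "finite S" unfolding S_def by (simp add: finite_permutations)
  have idS: "id \<in> S" unfolding S_def by (simp add: permutes_id)
  have cp: "charpoly A = t id + (\<Sum>p\<in>S - {id}. t p)"
    unfolding charpoly_def det_def C_def[symmetric] t_def S_def[symmetric]
    by (rule sum.remove[OF fS idS])
  have tid: "t id = (\<Prod>i\<in>UNIV. [:- A $ i $ i, 1:])"
    by (simp add: t_def C_def)
  have d1: "degree (t id) = CARD('n)"
    unfolding tid by (subst degree_prod_sum_eq) auto
  have l1: "lead_coeff (t id) = 1"
    unfolding tid by (simp add: lead_coeff_prod)
  have small: "degree (t p) < CARD('n)" if "p \<in> S - {id}" for p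
  proof -
    from that obtain i0 where i0: "p i0 \<noteq> i0" by (auto simp: fun_eq_iff)
    have "degree (t p) \<le> degree (of_int (sign p) :: complex poly)
        + degree (\<Prod>i\<in>UNIV. C $ i $ p i)"
      unfolding t_def by (rule degree_mult_le)
    also have "degree (of_int (sign p) :: complex poly) = 0" by simp
    also have "degree (\<Prod>i\<in>UNIV. C $ i $ p i) \<le> (\<Sum>i\<in>UNIV. degree (C $ i $ p i))"
      using degree_prod_sum_le[of UNIV "\<lambda>i. C $ i $ p i"] by (simp add: o_def)
    also have "\<dots> < (\<Sum>i\<in>(UNIV::'n set). 1)"
      by (rule sum_strict_mono_ex1) (use i0 in \<open>auto simp: C_def intro!: exI[of _ i0]\<close>)
    finally show ?thesis by simp
  qed
  have rest: "degree (\<Sum>p\<in>S - {id}. t p) < degree (t id)"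
    unfolding d1 by (rule degree_sum_less) (auto simp: small)
  show d: "degree (charpoly A) = CARD('n)"
    unfolding cp using d1 rest by (simp add: degree_add_eq_left)
  show "lead_coeff (charpoly A) = 1"
    using l1 d d1 rest unfolding cp by (simp add: coeff_eq_0)
qed

lemma charpoly_eigval:
  fixes A :: "complex^'n^'n"
  shows "charpoly A = (\<Prod>k\<in>UNIV. [:- eigval A k, 1:])"
proof -
  have "charpoly A \<noteq> 0" using charpoly_monic(2)[of A] by auto
  from alg_closed_imp_factorization[OF this] obtain E
    where E: "size E = CARD('n)" "charpoly A = (\<Prod>x\<in>#E. [:-x, 1:])"
    using charpoly_monic[of A] by auto
  obtain xs where xs: "mset xs = E" by (metis ex_mset)
  obtain f :: "'n \<Rightarrow> nat" where f: "bij_betw f UNIV {..<CARD('n)}"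
    using ex_bij_betw_finite_nat[of "UNIV::'n set"] by (auto simp: atLeast0LessThan)
  have "(\<Prod>k\<in>UNIV. [:- (xs ! f k), 1:]) = (\<Prod>i<CARD('n). [:- (xs ! i), 1:])"
    by (rule prod.reindex_bij_betw[OF f])
  also have "\<dots> = (\<Prod>x\<leftarrow>xs. [:-x, 1:])"
    using E(1) xs by (auto simp: prod.list_conv_set_nth atLeast0LessThan)
  also have "\<dots> = charpoly A"
    unfolding E(2) xs[symmetric] by (simp flip: prod_mset_prod_list)
  finally have "charpoly A = (\<Prod>k\<in>UNIV. [:- (xs ! f k), 1:])" by simp
  then show ?thesis
    unfolding eigval_def by (rule someI[where x = "\<lambda>k. xs ! f k"])
qed

definition eig_matching_dist :: "complex^'n^'n \<Rightarrow> complex^'n^'n \<Rightarrow> real" where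
  "eig_matching_dist A A' =
     Min ((\<lambda>\<pi>. Max (range (\<lambda>k. cmod (eigval A k - eigval A' (\<pi> k))))) ` {\<pi>. \<pi> permutes UNIV})"

definition eigenvector_matrix :: "complex^'n^'n \<Rightarrow> complex^'n^'n \<Rightarrow> bool" where
  "eigenvector_matrix A V \<longleftrightarrow>
     invertible V \<and> (\<forall>k. \<exists>c. A *v column k V = c *s column k V)"

definition diagonalisable :: "complex^'n^'n \<Rightarrow> bool" where
  "diagonalisable A \<longleftrightarrow>
     (\<exists>(V :: complex^'n^'n) (D :: complex^'n^'n).
        invertible V \<and> (\<forall>i j. i \<noteq> j \<longrightarrow> D $ i $ j = 0)
        \<and> A = V ** D ** matrix_inv V)"

definition spectral_norm :: "complex^'n^'n \<Rightarrow> real" where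
  "spectral_norm A = onorm (\<lambda>v. A *v v)"

definition cond2 :: "complex^'n^'n \<Rightarrow> real" where
  "cond2 V = spectral_norm V * spectral_norm (matrix_inv V)"

definition matrix_class :: "real \<Rightarrow> real \<Rightarrow> (complex^'n^'n) set" where
  "matrix_class \<Delta> \<kappa>0 =
     {A. diagonalisable A \<and> inj (eigval A)
       \<and> (\<forall>j k. j \<noteq> k \<longrightarrow> \<Delta> \<le> cmod (eigval A j - eigval A k))
       \<and> (\<exists>V. eigenvector_matrix A V \<and> cond2 V \<le> \<kappa>0)}"

text \<open>The Gaussian law on \<open>complex^'n\<close> with mean \<open>0\<close> and covariance
  \<open>E (e e*) = \<sigma>\<^sup>2 I\<close>, circularly symmetric: the real and the imaginary part of each
  coordinate are independent real Gaussians of variance \<open>\<sigma>\<^sup>2 / 2\<close>.\<close>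

definition complex_gaussian :: "real \<Rightarrow> (complex^'n) measure" where
  "complex_gaussian \<sigma> = density lborel
     (\<lambda>z. ennreal (exp (- (norm z)\<^sup>2 / \<sigma>\<^sup>2) / (pi * \<sigma>\<^sup>2) ^ CARD('n)))"

definition cvec :: "real^'p \<Rightarrow> complex^'p" where
  "cvec u = (\<chi> j. complex_of_real (u $ j))"

text \<open>The sample \<open>(x\<^sub>i, u\<^sub>i, y\<^sub>i)\<close>, \<open>i = 1, \<dots>, M\<close>, with
  \<open>y\<^sub>i = A \<Psi>(x\<^sub>i) + B u\<^sub>i + e\<^sub>i\<close>.\<close>

definition observed_data ::
  "(real^'d \<Rightarrow> complex^'n) \<Rightarrow> complex^'p^'n \<Rightarrow> nat
   \<Rightarrow> (nat \<Rightarrow> 'w \<Rightarrow> real^'d) \<Rightarrow> (nat \<Rightarrow> 'w \<Rightarrow> real^'p) \<Rightarrow> (nat \<Rightarrow> 'w \<Rightarrow> complex^'n)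
   \<Rightarrow> complex^'n^'n \<Rightarrow> 'w \<Rightarrow> nat \<Rightarrow> (real^'d) \<times> (real^'p) \<times> (complex^'n)" where
  "observed_data \<Psi> B M x u e A \<omega> =
     (\<lambda>i\<in>{1..M}. (x i \<omega>, u i \<omega>, A *v \<Psi> (x i \<omega>) + B *v cvec (u i \<omega>) + e i \<omega>))"

definition estimators ::
  "(real^'d) measure \<Rightarrow> (real^'p) measure \<Rightarrow> nat
   \<Rightarrow> ((nat \<Rightarrow> (real^'d) \<times> (real^'p) \<times> (complex^'n)) \<Rightarrow> complex^'n^'n) set" where
  "estimators \<mu> \<nu> M = (\<Pi>\<^sub>M i\<in>{1..M}. \<mu> \<Otimes>\<^sub>M (\<nu> \<Otimes>\<^sub>M borel)) \<rightarrow>\<^sub>M borel"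

end

theory Submission
  imports Defs
begin

text \<open>
  Le Cam's two-point method with \<open>\<delta> = \<sigma> / sqrt (2 g1 M)\<close>. Take \<open>A0\<close> diagonal with entries in
  \<open>2 \<Delta> \<nat>\<close> and entry \<open>0\<close> at the position of \<open>\<psi>\<^sub>1\<close>, and let \<open>A1\<close> arise by moving this entry to
  \<open>\<delta> \<le> \<Delta> / 2\<close>. No matrix has spectrum within less than \<open>\<delta> / 2\<close> of both, so the two losses add up to
  at least \<open>\<delta>\<close>. Conditionally on the design, passing from \<open>A0\<close> to \<open>A1\<close> shifts the Gaussian noise by
  \<open>\<delta> \<psi>\<^sub>1(x\<^sub>i)\<close> in one coordinate. The inequality \<open>3 min (1, R) \<ge> 4 sqrt R - 1 - R\<close> for the
  likelihood ratio \<open>R\<close>, together with the Hellinger affinity \<open>exp (- s / 4) \<ge> 1 - s / 4\<close>, where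
  \<open>s = \<Sum>\<^sub>i \<bar>\<delta> \<psi>\<^sub>1(x\<^sub>i)\<bar>\<^sup>2 / \<sigma>\<^sup>2\<close> has mean \<open>1 / 2\<close>, bounds the overlap of the two laws
  below by \<open>1 / 2\<close>. Hence one of the two risks is at least \<open>\<delta> / 4\<close>.

  The loss \<open>eig_matching_dist\<close> is built from an arbitrary choice of eigenvalue order. It is still Borel
  in its first argument, because its sublevel sets are projections, along a compact set of root tuples,
  of a closed set.
\<close>

section \<open>Eigenvalues and the matching distance\<close>

text \<open>Evaluation at \<open>z\<close> is a ring homomorphism, so it commutes with the
  determinant. This trades identities of polynomials for equations between numbers that depend
  continuously on the entries of \<open>A\<close>.\<close>

lemma poly_charpoly:
  "poly (charpoly A) z = det (\<chi> i j. (if i = j then z else 0) - A $ i $ j)"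
proof -
  have "poly (if i = j then [:- A $ i $ j, 1:] else [:- A $ i $ j:]) z
      = (if i = j then z else 0) - A $ i $ j" for i j
    by simp
  then show ?thesis
    unfolding charpoly_def det_def
    by (simp add: poly_sum poly_prod del: if_distrib)
qed

lemma charpoly_diagonal:
  "charpoly (\<chi> i j. if i = j then d i else 0) = (\<Prod>k\<in>UNIV. [:- d k, 1:])"
  unfolding charpoly_def by (subst det_diagonal) auto

text \<open>Both sides say that the multisets of roots agree, and two families over a finite index
  type have the same multiset of values exactly when a permutation carries one to the other.\<close>

lemma prod_linear_factors_eq_iff:
  fixes f g :: "'n::finite \<Rightarrow> complex"
  shows "(\<Prod>k\<in>UNIV. [:- f k, 1:]) = (\<Prod>k\<in>UNIV. [:- g k, 1:])
    \<longleftrightarrow> (\<exists>\<pi>. \<pi> permutes UNIV \<and> f = g \<circ> \<pi>)"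
proof
  have roots: "proots (\<Prod>k\<in>UNIV. [:- h k, 1:]) = image_mset h (mset_set UNIV)"
    for h :: "'n \<Rightarrow> complex"
    by (subst proots_prod) (auto simp: sum_unfold_sum_mset)
  assume "(\<Prod>k\<in>UNIV. [:- f k, 1:]) = (\<Prod>k\<in>UNIV. [:- g k, 1:])"
  then have "image_mset f (mset_set UNIV) = image_mset g (mset_set UNIV)"
    by (metis roots)
  then obtain p where "p permutes UNIV" "\<forall>x\<in>UNIV. f x = g (p x)"
    using image_mset_eq_implies_permutes[OF finite] by blast
  then show "\<exists>\<pi>. \<pi> permutes UNIV \<and> f = g \<circ> \<pi>"
    by (intro exI[of _ p]) auto
next
  assume "\<exists>\<pi>. \<pi> permutes UNIV \<and> f = g \<circ> \<pi>"
  then obtain p where p: "p permutes UNIV" "f = g \<circ> p" by blast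
  show "(\<Prod>k\<in>UNIV. [:- f k, 1:]) = (\<Prod>k\<in>UNIV. [:- g k, 1:])"
    using prod.permute[OF p(1), of "\<lambda>k. [:- g k, 1:]"] p(2) by (simp add: o_def)
qed

text \<open>All that can be known of the choice behind \<open>eigval\<close>: any factorisation
  determines it up to a permutation.\<close>

lemma charpoly_eq_iff:
  "charpoly A = (\<Prod>k\<in>UNIV. [:- l k, 1:]) \<longleftrightarrow> (\<exists>\<pi>. \<pi> permutes UNIV \<and> eigval A = l \<circ> \<pi>)"
  by (simp add: charpoly_eigval prod_linear_factors_eq_iff)

lemma eig_matching_dist_le_iff:
  fixes A A' :: "complex^'n^'n"
  shows "eig_matching_dist A A' \<le> r \<longleftrightarrow>
    (\<exists>\<pi>. \<pi> permutes UNIV \<and> (\<forall>k. cmod (eigval A k - eigval A' (\<pi> k)) \<le> r))"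
proof -
  have "finite {\<pi>. \<pi> permutes (UNIV::'n set)}" by (simp add: finite_permutations)
  moreover have "{\<pi>. \<pi> permutes (UNIV::'n set)} \<noteq> {}" using permutes_id by blast
  ultimately show ?thesis
    unfolding eig_matching_dist_def by (subst Min_le_iff) auto
qed

lemma eig_matching_dist_attained:
  obtains \<pi> where "\<pi> permutes UNIV"
    "\<And>k. cmod (eigval A k - eigval A' (\<pi> k)) \<le> eig_matching_dist A A'"
  using eig_matching_dist_le_iff[of A A' "eig_matching_dist A A'"] by auto

lemma eig_matching_dist_nonneg: "eig_matching_dist A A' \<ge> 0"
  by (rule eig_matching_dist_attained[of A A']) (meson norm_ge_zero order_trans)

text \<open>The permutation is absorbed into the listing \<open>l\<close> of the roots. The order
  chosen by \<open>eigval A\<close> thereby disappears, and \<open>A\<close> enters only through its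
  characteristic polynomial; this is what makes measurability in \<open>A\<close>
  accessible.\<close>

lemma eig_matching_dist_le_iff_charpoly:
  fixes A A' :: "complex^'n^'n"
  shows "eig_matching_dist A A' \<le> r \<longleftrightarrow>
    (\<exists>l. (\<forall>k. cmod (l $ k - eigval A' k) \<le> r) \<and> charpoly A = (\<Prod>k\<in>UNIV. [:- (l $ k), 1:]))"
  (is "?L \<longleftrightarrow> ?R")
proof
  assume ?L
  then obtain p where p: "p permutes UNIV" "\<And>k. cmod (eigval A k - eigval A' (p k)) \<le> r"
    by (auto simp: eig_matching_dist_le_iff)
  \<comment> \<open>Listing the eigenvalues of \<open>A\<close> along \<open>q\<close> puts each one
    at the index of its partner, so the matching becomes a coordinatewise bound.\<close>
  define q where "q = inv p"
  have q: "q permutes UNIV" "\<And>k. p (q k) = k" "\<And>k. q (p k) = k"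
    using p(1) by (simp_all add: q_def permutes_inv permutes_inverses)
  have "cmod ((\<chi> k. eigval A (q k)) $ k - eigval A' k) \<le> r" for k
    using p(2)[of "q k"] q by simp
  moreover have "eigval A = (\<lambda>k. eigval A (q k)) \<circ> p" by (simp add: q fun_eq_iff)
  then have "charpoly A = (\<Prod>k\<in>UNIV. [:- ((\<chi> k. eigval A (q k)) $ k), 1:])"
    using p(1) unfolding charpoly_eq_iff by (intro exI[of _ p]) (simp add: o_def)
  ultimately show ?R by blast
next
  assume ?R
  then obtain l :: "complex^'n" where l: "\<And>k. cmod (l $ k - eigval A' k) \<le> r"
    "charpoly A = (\<Prod>k\<in>UNIV. [:- (l $ k), 1:])" by blast
  from l(2) obtain p where "p permutes UNIV" "eigval A = ($) l \<circ> p"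
    unfolding charpoly_eq_iff by blast
  then show ?L using l(1) by (auto simp: eig_matching_dist_le_iff)
qed

lemma closed_eig_matching_dist_le:
  fixes A' :: "complex^'n^'n"
  shows "closed {A. eig_matching_dist A A' \<le> r}"
proof -
  \<comment> \<open>The product of discs containing the candidate root tuples depends on
    \<open>A'\<close> and \<open>r\<close> alone, so one compact set serves all
    \<open>A\<close>.\<close>
  define K :: "(complex^'n) set" where "K = {l. \<forall>k. l $ k \<in> cball (eigval A' k) r}"
  have "bounded K"
  proof (rule boundedI)
    fix l assume l: "l \<in> K"
    have "norm l \<le> (\<Sum>k\<in>UNIV. norm (l $ k))" by (simp add: norm_vec_def L2_set_le_sum)
    also have "\<dots> \<le> (\<Sum>k\<in>UNIV. cmod (eigval A' k) + r)"
    proof (rule sum_mono)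
      fix k
      have "dist (eigval A' k) (l $ k) \<le> r" using l by (auto simp: K_def)
      then show "norm (l $ k) \<le> cmod (eigval A' k) + r"
        using norm_triangle_sub[of "l $ k" "eigval A' k"] by (simp add: dist_norm norm_minus_commute)
    qed
    finally show "norm l \<le> (\<Sum>k\<in>UNIV. cmod (eigval A' k) + r)" .
  qed
  moreover have "closed K"
    unfolding K_def mem_cball by (intro closed_Collect_all closed_Collect_le continuous_intros)
  ultimately have K: "compact K" by (simp add: compact_eq_bounded_closed)
  \<comment> \<open>Equality of the two polynomials is imposed at every \<open>z\<close> separately:
    an intersection of closed conditions, since both sides are polynomial in the entries of
    \<open>x\<close>.\<close>
  define T where "T = {x :: (complex^'n) \<times> (complex^'n^'n).
    \<forall>z. det (\<chi> i j. (if i = j then z else 0) - snd x $ i $ j) = (\<Prod>k\<in>UNIV. z - fst x $ k)}"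
  have "closed T"
    unfolding T_def det_def
    by (intro closed_Collect_all closed_Collect_eq) (simp_all, (intro continuous_intros)+)
  then have "closed {A. \<exists>l. l \<in> K \<and> (l, A) \<in> T}"
    by (intro closed_compact_projection[OF K])
  also have "{A. \<exists>l. l \<in> K \<and> (l, A) \<in> T} = {A. eig_matching_dist A A' \<le> r}"
    unfolding eig_matching_dist_le_iff_charpoly T_def K_def
    by (auto simp: poly_eq_poly_eq_iff[symmetric] fun_eq_iff poly_charpoly poly_prod dist_norm
        norm_minus_commute)
  finally show ?thesis .
qed

lemma borel_measurable_eig_matching_dist [measurable]:
  "(\<lambda>A. eig_matching_dist A A') \<in> borel_measurable borel"
  by (rule borel_measurableI_le) (simp add: closed_eig_matching_dist_le borel_closed)

lemma eigval_diagonal: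
  obtains \<pi> where "\<pi> permutes UNIV" "eigval (\<chi> i j. if i = j then d i else 0) = d \<circ> \<pi>"
  using charpoly_diagonal[of d] unfolding charpoly_eq_iff by blast

lemma spectral_norm_mat_1: "spectral_norm (mat 1 :: complex^'n^'n) = 1"
proof -
  have "(*v) (mat 1 :: complex^'n^'n) = (\<lambda>v. v)" by (simp add: fun_eq_iff)
  then show ?thesis by (simp add: spectral_norm_def onorm_id)
qed

lemma matrix_inv_mat_1: "matrix_inv (mat 1 :: complex^'n^'n) = mat 1"
  unfolding matrix_inv_def by (rule some_equality) auto

lemma invertible_mat_1: "invertible (mat 1 :: complex^'n^'n)"
  unfolding invertible_def by (intro exI[of _ "mat 1"]) simp

text \<open>The standard basis consists of eigenvectors, so \<open>mat 1\<close>, with condition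
  number 1, is an admissible eigenvector matrix for every \<kappa>0 \<ge> 1.\<close>

lemma diagonal_in_matrix_class:
  fixes d :: "'n::finite \<Rightarrow> complex"
  assumes "\<Delta> > 0" "\<kappa>0 \<ge> 1" and sep: "\<And>j k. j \<noteq> k \<Longrightarrow> \<Delta> \<le> cmod (d j - d k)"
  shows "(\<chi> i j. if i = j then d i else 0) \<in> matrix_class \<Delta> \<kappa>0"
proof -
  let ?A = "\<chi> i j. if i = j then d i else 0"
  obtain p where p: "p permutes UNIV" "eigval ?A = d \<circ> p" by (rule eigval_diagonal)
  have injp: "inj p" using p(1) by (simp add: permutes_inj)
  have "inj d" using sep \<open>\<Delta> > 0\<close> by (intro injI) force
  then have "inj (eigval ?A)" using p injp by (simp add: inj_compose)
  moreover have "\<forall>j k. j \<noteq> k \<longrightarrow> \<Delta> \<le> cmod (eigval ?A j - eigval ?A k)"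
    using sep injp p(2) by (auto simp: inj_eq)
  moreover have "diagonalisable ?A"
    unfolding diagonalisable_def
    by (intro exI[of _ "mat 1"] exI[of _ ?A]) (auto simp: matrix_inv_mat_1 invertible_mat_1)
  moreover have "?A *v column k (mat 1) = d k *s column k (mat 1)" for k
    by (auto simp: vec_eq_iff matrix_vector_mult_def column_def mat_def if_distrib
        cong: if_cong intro!: sum.neutral)
  then have "eigenvector_matrix ?A (mat 1)"
    unfolding eigenvector_matrix_def by (auto simp: invertible_mat_1)
  moreover have "cond2 (mat 1 :: complex^'n^'n) \<le> \<kappa>0"
    using assms by (simp add: cond2_def matrix_inv_mat_1 spectral_norm_mat_1)
  ultimately show ?thesis unfolding matrix_class_def by blast
qed

text \<open>Some eigenvalue of \<open>A\<close> is matched to \<open>c i\<close> in the first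
  distance, and the same eigenvalue is matched to some \<open>d j\<close> in the second; the
  triangle inequality through it gives the bound.\<close>

lemma eig_matching_dist_diagonal_sum_ge:
  fixes c d :: "'n::finite \<Rightarrow> complex"
  assumes sep: "\<And>j. \<delta> \<le> cmod (d j - c i)"
  shows "\<delta> \<le> eig_matching_dist A (\<chi> i j. if i = j then c i else 0)
    + eig_matching_dist A (\<chi> i j. if i = j then d i else 0)" (is "_ \<le> ?r + ?s")
proof -
  obtain p where p: "p permutes UNIV" "eigval (\<chi> i j. if i = j then c i else 0) = c \<circ> p"
    by (rule eigval_diagonal)
  obtain q where q: "eigval (\<chi> i j. if i = j then d i else 0) = d \<circ> q" by (rule eigval_diagonal)
  obtain a where a: "a permutes UNIV"
    "\<And>k. cmod (eigval A k - eigval (\<chi> i j. if i = j then c i else 0) (a k)) \<le> ?r"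
    by (rule eig_matching_dist_attained[of A "\<chi> i j. if i = j then c i else 0"]) blast
  obtain b where b: "\<And>k. cmod (eigval A k - eigval (\<chi> i j. if i = j then d i else 0) (b k)) \<le> ?s"
    by (rule eig_matching_dist_attained[of A "\<chi> i j. if i = j then d i else 0"]) blast
  have "surj (p \<circ> a)" using p(1) a(1) by (intro permutes_surj permutes_compose)
  then obtain k where k: "p (a k) = i" by (metis comp_apply surjD)
  have c: "cmod (eigval A k - c i) \<le> ?r" using a(2)[of k] k by (simp add: p(2))
  have d: "cmod (eigval A k - d (q (b k))) \<le> ?s" using b[of k] by (simp add: q)
  have "\<delta> \<le> cmod ((eigval A k - c i) - (eigval A k - d (q (b k))))" using sep by simp
  also have "\<dots> \<le> cmod (eigval A k - c i) + cmod (eigval A k - d (q (b k)))"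
    by (rule norm_triangle_ineq4)
  also have "\<dots> \<le> ?r + ?s" using c d by (rule add_mono)
  finally show ?thesis .
qed

lemma diagonal_matrix_vector_mult:
  fixes d :: "'n::finite \<Rightarrow> 'a::semiring_1"
  shows "(\<chi> i j. if i = j then d i else 0) *v y = (\<chi> i. d i * y $ i)"
proof -
  have "(if i = j then d i else 0) * y $ j = (if i = j then d i * y $ i else 0)" for i j by simp
  then show ?thesis by (simp add: vec_eq_iff matrix_vector_mult_def)
qed

lemma norm_axis:
  fixes y :: "'a::real_normed_vector"
  shows "norm (axis k y :: 'a^'n) = norm y"
proof -
  have "(norm (axis k y $ i :: 'a))\<^sup>2 = (if i = k then (norm y)\<^sup>2 else 0)" for i :: 'n
    by (simp add: axis_def)
  then show ?thesis by (simp add: norm_vec_def L2_set_def)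
qed

section \<open>Gaussian shifts\<close>

text \<open>Coordinatewise substitutions have the product of the one-coordinate densities as their
  density. The induction splits off one coordinate at a time by Tonelli.\<close>

lemma (in product_sigma_finite) nn_integral_PiM_change_of_variables:
  assumes "finite I"
    and "\<And>i. i \<in> I \<Longrightarrow> T i \<in> M i \<rightarrow>\<^sub>M M i"
    and "\<And>i. i \<in> I \<Longrightarrow> w i \<in> borel_measurable (M i)"
    and "\<And>i h. i \<in> I \<Longrightarrow> h \<in> borel_measurable (M i) \<Longrightarrow>
      (\<integral>\<^sup>+y. h (T i y) \<partial>M i) = (\<integral>\<^sup>+y. h y * w i y \<partial>M i)"
    and "f \<in> borel_measurable (Pi\<^sub>M I M)"
  shows "(\<integral>\<^sup>+x. f (\<lambda>i\<in>I. T i (x i)) \<partial>Pi\<^sub>M I M) =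
    (\<integral>\<^sup>+x. f x * (\<Prod>i\<in>I. w i (x i)) \<partial>Pi\<^sub>M I M)"
  using assms
proof (induction I arbitrary: f rule: finite_induct)
  case empty
  then show ?case by (simp add: PiM_empty restrict_def nn_integral_count_space_finite)
next
  case (insert i I)
  have T[measurable]: "T j \<in> M j \<rightarrow>\<^sub>M M j" if "j \<in> insert i I" for j using insert that by blast
  have w[measurable]: "w j \<in> borel_measurable (M j)" if "j \<in> insert i I" for j
    using insert that by blast
  note f[measurable] = \<open>f \<in> borel_measurable (Pi\<^sub>M (insert i I) M)\<close>
  have Ti[measurable]: "T i \<in> M i \<rightarrow>\<^sub>M M i" and wi[measurable]: "w i \<in> borel_measurable (M i)"
    by simp_all
  have upd[measurable]: "(\<lambda>(x, y). x(i := y)) \<in> Pi\<^sub>M I M \<Otimes>\<^sub>M M i \<rightarrow>\<^sub>M Pi\<^sub>M (insert i I) M"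
    by (simp add: measurable_add_dim)
  have mapT: "(\<lambda>x. \<lambda>j\<in>J. T j (x j)) \<in> Pi\<^sub>M J M \<rightarrow>\<^sub>M Pi\<^sub>M J M" if "J \<subseteq> insert i I" for J
  proof (rule measurable_restrict)
    fix j assume "j \<in> J"
    with that show "(\<lambda>x. T j (x j)) \<in> Pi\<^sub>M J M \<rightarrow>\<^sub>M M j"
      using measurable_compose[OF measurable_component_singleton[of j J M] T] by auto
  qed
  have wprod: "(\<lambda>x. \<Prod>j\<in>J. w j (x j)) \<in> borel_measurable (Pi\<^sub>M J M)" if "J \<subseteq> insert i I" for J
  proof (rule borel_measurable_prod_ennreal)
    fix j assume "j \<in> J"
    with that show "(\<lambda>x. w j (x j)) \<in> borel_measurable (Pi\<^sub>M J M)"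
      using measurable_compose[OF measurable_component_singleton[of j J M] w] by auto
  qed
  \<comment> \<open>The new coordinate is integrated out after its own substitution; the induction
    hypothesis, general in the integrand, then handles the others with \<open>h\<close> in place of
    \<open>f\<close>.\<close>
  define h where "h x = (\<integral>\<^sup>+y. f (x(i := y)) * w i y \<partial>M i)" for x
  have h: "h \<in> borel_measurable (Pi\<^sub>M I M)"
    unfolding h_def by measurable
  have "(\<integral>\<^sup>+x. f (\<lambda>j\<in>insert i I. T j (x j)) \<partial>Pi\<^sub>M (insert i I) M)
      = (\<integral>\<^sup>+x. \<integral>\<^sup>+y. f (\<lambda>j\<in>insert i I. T j ((x(i := y)) j)) \<partial>M i \<partial>Pi\<^sub>M I M)"
    using insert.hyps measurable_compose[OF mapT f] by (intro product_nn_integral_insert) auto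
  also have "\<dots> = (\<integral>\<^sup>+x. h (\<lambda>j\<in>I. T j (x j)) \<partial>Pi\<^sub>M I M)"
  proof (rule nn_integral_cong)
    fix x assume x: "x \<in> space (Pi\<^sub>M I M)"
    then have Tx: "(\<lambda>j\<in>I. T j (x j)) \<in> space (Pi\<^sub>M I M)"
      by (intro measurable_space[OF mapT]) auto
    have "(\<lambda>j\<in>insert i I. T j ((x(i := y)) j)) = (\<lambda>j\<in>I. T j (x j))(i := T i y)" for y
      using \<open>i \<notin> I\<close> by (auto simp: fun_eq_iff)
    moreover have "(\<lambda>y. f ((\<lambda>j\<in>I. T j (x j))(i := y))) \<in> borel_measurable (M i)"
      using measurable_compose[OF measurable_Pair1'[OF Tx] measurable_compose[OF upd f]] by simp
    ultimately show "(\<integral>\<^sup>+y. f (\<lambda>j\<in>insert i I. T j ((x(i := y)) j)) \<partial>M i) = h (\<lambda>j\<in>I. T j (x j))"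
      using insert.prems(3)[of i "\<lambda>y. f ((\<lambda>j\<in>I. T j (x j))(i := y))"] by (simp add: h_def)
  qed
  also have "\<dots> = (\<integral>\<^sup>+x. h x * (\<Prod>j\<in>I. w j (x j)) \<partial>Pi\<^sub>M I M)"
    using insert.prems by (intro insert.IH h) auto
  also have "\<dots> = (\<integral>\<^sup>+x. \<integral>\<^sup>+y. f (x(i := y)) * (\<Prod>j\<in>insert i I. w j ((x(i := y)) j)) \<partial>M i \<partial>Pi\<^sub>M I M)"
  proof (rule nn_integral_cong)
    fix x assume x: "x \<in> space (Pi\<^sub>M I M)"
    have "(\<Prod>j\<in>insert i I. w j ((x(i := y)) j)) = w i y * (\<Prod>j\<in>I. w j (x j))" for y
      using insert.hyps by (simp, intro arg_cong2[where f = "(*)"] prod.cong) auto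
    moreover have "(\<lambda>y. f (x(i := y))) \<in> borel_measurable (M i)"
      using measurable_compose[OF measurable_Pair1'[OF x] measurable_compose[OF upd f]] by simp
    ultimately show "h x * (\<Prod>j\<in>I. w j (x j)) =
        (\<integral>\<^sup>+y. f (x(i := y)) * (\<Prod>j\<in>insert i I. w j ((x(i := y)) j)) \<partial>M i)"
      unfolding h_def by (subst nn_integral_multc[symmetric]) (auto simp: mult.assoc)
  qed
  also have "\<dots> = (\<integral>\<^sup>+x. f x * (\<Prod>j\<in>insert i I. w j (x j)) \<partial>Pi\<^sub>M (insert i I) M)"
    using insert.hyps wprod[OF order_refl] by (intro product_nn_integral_insert[symmetric]) auto
  finally show ?case .
qed

lemma sets_complex_gaussian [measurable_cong, simp]: "sets (complex_gaussian \<sigma>) = sets borel"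
  by (simp add: complex_gaussian_def)

lemma space_complex_gaussian [simp]: "space (complex_gaussian \<sigma>) = UNIV"
  by (simp add: complex_gaussian_def)

text \<open>The Cameron-Martin formula: Lebesgue measure is translation invariant, so the weight is
  the ratio of the Gaussian densities at \<open>z - m\<close> and \<open>z\<close>.\<close>

lemma nn_integral_complex_gaussian_shift:
  fixes f :: "complex^'n \<Rightarrow> ennreal"
  assumes [measurable]: "f \<in> borel_measurable borel"
  shows "(\<integral>\<^sup>+z. f (z + m) \<partial>complex_gaussian \<sigma>) =
    (\<integral>\<^sup>+z. f z * ennreal (exp ((2 * (z \<bullet> m) - (norm m)\<^sup>2) / \<sigma>\<^sup>2)) \<partial>complex_gaussian \<sigma>)"
proof -
  define \<phi> :: "complex^'n \<Rightarrow> real"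
    where "\<phi> z = exp (- (norm z)\<^sup>2 / \<sigma>\<^sup>2) / (pi * \<sigma>\<^sup>2) ^ CARD('n)" for z
  have [measurable]: "\<phi> \<in> borel_measurable borel" unfolding \<phi>_def by measurable
  have shift: "ennreal (\<phi> (z - m)) = ennreal (\<phi> z) * ennreal (exp ((2 * (z \<bullet> m) - (norm m)\<^sup>2) / \<sigma>\<^sup>2))" for z
  proof -
    have "(norm (z - m))\<^sup>2 = (norm z)\<^sup>2 - (2 * (z \<bullet> m) - (norm m)\<^sup>2)"
      unfolding power2_norm_eq_inner by (simp add: algebra_simps inner_commute)
    then have "exp (- (norm (z - m))\<^sup>2 / \<sigma>\<^sup>2)
        = exp (- (norm z)\<^sup>2 / \<sigma>\<^sup>2) * exp ((2 * (z \<bullet> m) - (norm m)\<^sup>2) / \<sigma>\<^sup>2)"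
      by (simp flip: exp_add add: diff_divide_distrib)
    then have "\<phi> (z - m) = \<phi> z * exp ((2 * (z \<bullet> m) - (norm m)\<^sup>2) / \<sigma>\<^sup>2)"
      by (simp add: \<phi>_def)
    moreover have "\<phi> z \<ge> 0" by (simp add: \<phi>_def)
    ultimately show ?thesis by (simp add: ennreal_mult)
  qed
  have "(\<integral>\<^sup>+z. f (z + m) \<partial>complex_gaussian \<sigma>) = (\<integral>\<^sup>+z. ennreal (\<phi> z) * f (z + m) \<partial>lborel)"
    unfolding complex_gaussian_def \<phi>_def[symmetric] by (subst nn_integral_density) auto
  also have "\<dots> = (\<integral>\<^sup>+z. ennreal (\<phi> (z - m)) * f z \<partial>distr lborel borel ((+) m))"
    by (subst nn_integral_distr) (auto simp: add.commute)
  also have "\<dots> = (\<integral>\<^sup>+z. ennreal (\<phi> z) *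
      (f z * ennreal (exp ((2 * (z \<bullet> m) - (norm m)\<^sup>2) / \<sigma>\<^sup>2))) \<partial>lborel)"
    unfolding lborel_distr_plus by (intro nn_integral_cong) (simp add: shift mult_ac)
  also have "\<dots> = (\<integral>\<^sup>+z. f z * ennreal (exp ((2 * (z \<bullet> m) - (norm m)\<^sup>2) / \<sigma>\<^sup>2)) \<partial>complex_gaussian \<sigma>)"
    unfolding complex_gaussian_def \<phi>_def[symmetric] by (subst nn_integral_density) auto
  finally show ?thesis .
qed

lemma nn_integral_PiM_complex_gaussian_shift:
  fixes m :: "'i \<Rightarrow> complex^'n"
  assumes "prob_space (complex_gaussian \<sigma> :: (complex^'n) measure)" and "finite I"
    and f: "f \<in> borel_measurable (\<Pi>\<^sub>M i\<in>I. borel)"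
  shows "(\<integral>\<^sup>+z. f (\<lambda>i\<in>I. z i + m i) \<partial>(\<Pi>\<^sub>M i\<in>I. complex_gaussian \<sigma>)) =
    (\<integral>\<^sup>+z. f z * ennreal (exp (\<Sum>i\<in>I. (2 * (z i \<bullet> m i) - (norm (m i))\<^sup>2) / \<sigma>\<^sup>2))
      \<partial>(\<Pi>\<^sub>M i\<in>I. complex_gaussian \<sigma>))"
proof -
  interpret G: prob_space "complex_gaussian \<sigma> :: (complex^'n) measure" by fact
  interpret product_sigma_finite "\<lambda>_::'i. complex_gaussian \<sigma> :: (complex^'n) measure"
    by standard
  have sets: "sets (\<Pi>\<^sub>M i\<in>I. (complex_gaussian \<sigma> :: (complex^'n) measure)) = sets (\<Pi>\<^sub>M i\<in>I. borel)"
    by (intro sets_PiM_cong) auto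
  have "(\<integral>\<^sup>+z. f (\<lambda>i\<in>I. z i + m i) \<partial>(\<Pi>\<^sub>M i\<in>I. complex_gaussian \<sigma>)) =
    (\<integral>\<^sup>+z. f z * (\<Prod>i\<in>I. ennreal (exp ((2 * (z i \<bullet> m i) - (norm (m i))\<^sup>2) / \<sigma>\<^sup>2)))
      \<partial>(\<Pi>\<^sub>M i\<in>I. complex_gaussian \<sigma>))"
    by (rule nn_integral_PiM_change_of_variables[where T = "\<lambda>i z. z + m i"])
      (use assms f in \<open>simp_all add: nn_integral_complex_gaussian_shift measurable_cong_sets[OF sets refl]
        cong: measurable_cong_sets\<close>)
  then show ?thesis by (simp add: prod_ennreal exp_sum \<open>finite I\<close>)
qed

text \<open>The difference of the two sides is \<open>(2 - a)\<^sup>2\<close> or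
  \<open>(2 * a - 1)\<^sup>2\<close>, according to which argument attains the minimum. It is used
  with \<open>a\<close> the square root of the likelihood ratio.\<close>

lemma four_sqrt_le_min:
  fixes a :: real
  shows "4 * a \<le> 3 * min 1 (a\<^sup>2) + 1 + a\<^sup>2"
  using zero_le_power2[of "2 - a"] zero_le_power2[of "2 * a - 1"]
  by (simp add: min_def power2_eq_square algebra_simps)

text \<open>Le Cam's bound for deterministic shifts \<open>m\<close>. It is written additively to
  avoid subtraction in \<open>ennreal\<close>, and linearly in the squared size of the shift, so
  that averaging over random shifts later needs only the mean of that size.\<close>

lemma two_point_bound_gaussian:
  fixes m :: "'i \<Rightarrow> complex^'n" and f g :: "('i \<Rightarrow> complex^'n) \<Rightarrow> ennreal"
  assumes prob: "prob_space (complex_gaussian \<sigma> :: (complex^'n) measure)" and I: "finite I"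
    and f: "f \<in> borel_measurable (\<Pi>\<^sub>M i\<in>I. borel)" and g: "g \<in> borel_measurable (\<Pi>\<^sub>M i\<in>I. borel)"
    and ge: "\<And>z. ennreal \<delta> \<le> f z + g z" and "\<delta> \<ge> 0"
  shows "ennreal (4 * \<delta>) \<le> 3 * ((\<integral>\<^sup>+z. f z \<partial>(\<Pi>\<^sub>M i\<in>I. complex_gaussian \<sigma>))
      + (\<integral>\<^sup>+z. g (\<lambda>i\<in>I. z i + m i) \<partial>(\<Pi>\<^sub>M i\<in>I. complex_gaussian \<sigma>)))
    + ennreal (2 * \<delta>) + ennreal (\<delta> * (\<Sum>i\<in>I. (norm (m i))\<^sup>2 / \<sigma>\<^sup>2))"
proof -
  let ?G = "\<Pi>\<^sub>M i\<in>I. (complex_gaussian \<sigma> :: (complex^'n) measure)"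
  interpret G: prob_space ?G by (intro prob_space_PiM prob)
  have sets: "sets ?G = sets (\<Pi>\<^sub>M i\<in>I. borel)" by (intro sets_PiM_cong) auto
  note [measurable_cong] = sets
  note [measurable] = f g
  define R where "R m' z = exp (\<Sum>i\<in>I. (2 * (z i \<bullet> m' i) - (norm (m' i))\<^sup>2) / \<sigma>\<^sup>2)"
    for m' z :: "'i \<Rightarrow> complex^'n"
  have R[measurable]: "(\<lambda>z. ennreal (R m' z)) \<in> borel_measurable ?G" for m'
    unfolding R_def by measurable
  \<comment> \<open>The shift formula for the constant 1 shows that likelihood ratios have total
    mass 1; it is applied to \<open>m\<close> and to the half shift.\<close>
  have intR: "(\<integral>\<^sup>+z. ennreal (R m' z) \<partial>?G) = 1" for m'
    using nn_integral_PiM_complex_gaussian_shift[OF prob I, of "\<lambda>_. 1" m']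
    by (simp add: R_def G.emeasure_space_1)
  have intg: "(\<integral>\<^sup>+z. g (\<lambda>i\<in>I. z i + m i) \<partial>?G) = (\<integral>\<^sup>+z. g z * ennreal (R m z) \<partial>?G)"
    unfolding R_def by (rule nn_integral_PiM_complex_gaussian_shift[OF prob I g])
  define s where "s = (\<Sum>i\<in>I. (norm (m i))\<^sup>2 / \<sigma>\<^sup>2)"
  have "s \<ge> 0" unfolding s_def by (intro sum_nonneg) simp
  define m' where "m' i = (1 / 2) *\<^sub>R m i" for i
  \<comment> \<open>The Hellinger density \<open>sqrt (R m)\<close> is \<open>exp (- s / 4)\<close> times the likelihood ratio of the
    half shift, which integrates to 1.\<close>
  have real: "4 * R m' z \<le> 3 * min 1 (R m z) + 1 + R m z + s * R m' z" for z
  proof -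
    define t where "t = (\<Sum>i\<in>I. (2 * (z i \<bullet> m i) - (norm (m i))\<^sup>2) / \<sigma>\<^sup>2)"
    \<comment> \<open>Halving the shift halves the linear term but quarters the quadratic one; the
      mismatch is the \<open>s / 4\<close>.\<close>
    have "(\<Sum>i\<in>I. (2 * (z i \<bullet> m' i) - (norm (m' i))\<^sup>2) / \<sigma>\<^sup>2) = t / 2 + s / 4"
      unfolding t_def s_def sum_divide_distrib sum.distrib[symmetric]
      by (intro sum.cong; cases "\<sigma> = 0") (auto simp: m'_def power2_eq_square field_simps)
    then have R': "R m' z = exp (t / 2) * exp (s / 4)" by (simp add: R_def exp_add)
    have Rm: "R m z = (exp (t / 2))\<^sup>2" by (simp add: R_def t_def flip: exp_double)
    \<comment> \<open>The affinity \<open>exp (- s / 4)\<close> is replaced by its tangent at 0,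
      which makes the final bound linear in \<open>s\<close>.\<close>
    have "1 - s / 4 \<le> exp (- s / 4)" using exp_ge_add_one_self[of "- s / 4"] by simp
    then have "(1 - s / 4) * R m' z \<le> exp (- s / 4) * R m' z"
      by (intro mult_right_mono) (auto simp: R_def)
    also have "\<dots> = exp (t / 2)" unfolding R' by (simp add: exp_minus)
    finally have "4 * R m' z - s * R m' z \<le> 4 * exp (t / 2)" by (simp add: algebra_simps)
    with four_sqrt_le_min[of "exp (t / 2)"] show ?thesis unfolding Rm by linarith
  qed
  have pointwise: "ennreal (4 * \<delta>) * ennreal (R m' z) \<le> 3 * (f z + g z * ennreal (R m z))
      + ennreal \<delta> + ennreal \<delta> * ennreal (R m z) + ennreal (\<delta> * s) * ennreal (R m' z)" for z
  proof -
    have pos: "R m z \<ge> 0" "R m' z \<ge> 0" by (auto simp: R_def)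
    \<comment> \<open>The minimum is dominated by 1 next to \<open>f\<close> and by the likelihood
      ratio next to \<open>g\<close>, so each loss is weighed by the density of its own law.\<close>
    have "ennreal \<delta> * ennreal (min 1 (R m z)) \<le> (f z + g z) * ennreal (min 1 (R m z))"
      by (intro mult_right_mono ge) simp
    also have "\<dots> \<le> f z * 1 + g z * ennreal (R m z)"
      unfolding distrib_right by (intro add_mono mult_left_mono) (auto simp: ennreal_leI)
    finally have *: "ennreal \<delta> * ennreal (min 1 (R m z)) \<le> f z + g z * ennreal (R m z)" by simp
    have "ennreal (4 * \<delta>) * ennreal (R m' z) = ennreal (\<delta> * (4 * R m' z))"
      using pos \<open>\<delta> \<ge> 0\<close> by (simp flip: ennreal_mult add: mult_ac)
    also have "\<dots> \<le> ennreal (\<delta> * (3 * min 1 (R m z) + 1 + R m z + s * R m' z))"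
      using real[of z] \<open>\<delta> \<ge> 0\<close> by (intro ennreal_leI mult_left_mono)
    also have "\<delta> * (3 * min 1 (R m z) + 1 + R m z + s * R m' z)
        = 3 * (\<delta> * min 1 (R m z)) + \<delta> + \<delta> * R m z + \<delta> * s * R m' z"
      by (simp add: algebra_simps)
    also have "ennreal \<dots> = 3 * (ennreal \<delta> * ennreal (min 1 (R m z))) + ennreal \<delta>
        + ennreal \<delta> * ennreal (R m z) + ennreal (\<delta> * s) * ennreal (R m' z)"
      using pos \<open>\<delta> \<ge> 0\<close> \<open>s \<ge> 0\<close> by (simp add: ennreal_mult)
    also have "\<dots> \<le> 3 * (f z + g z * ennreal (R m z)) + ennreal \<delta>
        + ennreal \<delta> * ennreal (R m z) + ennreal (\<delta> * s) * ennreal (R m' z)"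
      by (intro add_mono mult_left_mono * order_refl) auto
    finally show ?thesis .
  qed
  have "ennreal (4 * \<delta>) = (\<integral>\<^sup>+z. ennreal (4 * \<delta>) * ennreal (R m' z) \<partial>?G)"
    by (simp add: nn_integral_cmult intR)
  also have "\<dots> \<le> (\<integral>\<^sup>+z. 3 * (f z + g z * ennreal (R m z)) + ennreal \<delta>
        + ennreal \<delta> * ennreal (R m z) + ennreal (\<delta> * s) * ennreal (R m' z) \<partial>?G)"
    by (intro nn_integral_mono pointwise)
  also have "\<dots> = 3 * ((\<integral>\<^sup>+z. f z \<partial>?G) + (\<integral>\<^sup>+z. g (\<lambda>i\<in>I. z i + m i) \<partial>?G))
      + ennreal \<delta> + ennreal \<delta> + ennreal (\<delta> * s)"
    unfolding intg by (simp add: nn_integral_add nn_integral_cmult intR G.emeasure_space_1)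
  also have "\<dots> = 3 * ((\<integral>\<^sup>+z. f z \<partial>?G) + (\<integral>\<^sup>+z. g (\<lambda>i\<in>I. z i + m i) \<partial>?G))
      + ennreal (2 * \<delta>) + ennreal (\<delta> * s)"
    using \<open>\<delta> \<ge> 0\<close> by (simp add: add.assoc flip: ennreal_plus)
  finally show ?thesis unfolding s_def .
qed

section \<open>Independence and product measures\<close>

text \<open>Independence gives the product formula on measurable rectangles, and these determine a
  product of sigma-finite measures.\<close>

lemma (in prob_space) distr_pair_if_indep_set:
  assumes [measurable]: "random_variable S X" "random_variable T Y"
    and indep: "indep_set {X -` A \<inter> space M |A. A \<in> sets S} {Y -` A \<inter> space M |A. A \<in> sets T}"
  shows "distr M (S \<Otimes>\<^sub>M T) (\<lambda>\<omega>. (X \<omega>, Y \<omega>)) = distr M S X \<Otimes>\<^sub>M distr M T Y"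
proof (rule pair_measure_eqI[symmetric])
  show "sigma_finite_measure (distr M S X)" "sigma_finite_measure (distr M T Y)"
    by (intro prob_space_imp_sigma_finite prob_space_distr assms)+
  fix A B assume "A \<in> sets (distr M S X)" "B \<in> sets (distr M T Y)"
  then have [measurable]: "A \<in> sets S" "B \<in> sets T" by auto
  have "(\<lambda>\<omega>. (X \<omega>, Y \<omega>)) -` (A \<times> B) \<inter> space M = (X -` A \<inter> space M) \<inter> (Y -` B \<inter> space M)"
    by auto
  moreover have "prob \<dots> = prob (X -` A \<inter> space M) * prob (Y -` B \<inter> space M)"
    by (rule indep_setD[OF indep]) auto
  ultimately show "emeasure (distr M S X) A * emeasure (distr M T Y) B
      = emeasure (distr M (S \<Otimes>\<^sub>M T) (\<lambda>\<omega>. (X \<omega>, Y \<omega>))) (A \<times> B)"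
    by (simp add: emeasure_distr emeasure_eq_measure ennreal_mult)
qed simp

text \<open>Independence within each family makes its law a power of the marginal; independence
  between the families then makes the joint law a product.\<close>

lemma (in prob_space) distr_pair_indep_families:
  assumes I: "I \<noteq> {}"
    and X: "indep_vars (\<lambda>_. S) X I" "\<And>i. i \<in> I \<Longrightarrow> distr M S (X i) = N"
    and Y: "indep_vars (\<lambda>_. T) Y I" "\<And>i. i \<in> I \<Longrightarrow> distr M T (Y i) = N'"
    and indep: "indep_set
      {(\<lambda>\<omega>. \<lambda>i\<in>I. X i \<omega>) -` A \<inter> space M |A. A \<in> sets (\<Pi>\<^sub>M i\<in>I. S)}
      {(\<lambda>\<omega>. \<lambda>i\<in>I. Y i \<omega>) -` A \<inter> space M |A. A \<in> sets (\<Pi>\<^sub>M i\<in>I. T)}"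
  shows "distr M ((\<Pi>\<^sub>M i\<in>I. S) \<Otimes>\<^sub>M (\<Pi>\<^sub>M i\<in>I. T)) (\<lambda>\<omega>. (\<lambda>i\<in>I. X i \<omega>, \<lambda>i\<in>I. Y i \<omega>))
    = (\<Pi>\<^sub>M i\<in>I. N) \<Otimes>\<^sub>M (\<Pi>\<^sub>M i\<in>I. N')"
proof -
  have rvX: "random_variable S (X i)" and rvY: "random_variable T (Y i)" if "i \<in> I" for i
    using X(1) Y(1) that by (auto simp: indep_vars_def)
  have "distr M (\<Pi>\<^sub>M i\<in>I. S) (\<lambda>\<omega>. \<lambda>i\<in>I. X i \<omega>) = (\<Pi>\<^sub>M i\<in>I. N)"
    using indep_vars_iff_distr_eq_PiM'[OF I, where M' = "\<lambda>_. S" and X = X] rvX X by (simp cong: PiM_cong)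
  moreover have "distr M (\<Pi>\<^sub>M i\<in>I. T) (\<lambda>\<omega>. \<lambda>i\<in>I. Y i \<omega>) = (\<Pi>\<^sub>M i\<in>I. N')"
    using indep_vars_iff_distr_eq_PiM'[OF I, where M' = "\<lambda>_. T" and X = Y] rvY Y by (simp cong: PiM_cong)
  moreover have "distr M ((\<Pi>\<^sub>M i\<in>I. S) \<Otimes>\<^sub>M (\<Pi>\<^sub>M i\<in>I. T)) (\<lambda>\<omega>. (\<lambda>i\<in>I. X i \<omega>, \<lambda>i\<in>I. Y i \<omega>))
      = distr M (\<Pi>\<^sub>M i\<in>I. S) (\<lambda>\<omega>. \<lambda>i\<in>I. X i \<omega>) \<Otimes>\<^sub>M distr M (\<Pi>\<^sub>M i\<in>I. T) (\<lambda>\<omega>. \<lambda>i\<in>I. Y i \<omega>)"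
    by (intro distr_pair_if_indep_set indep measurable_restrict rvX rvY)
  ultimately show ?thesis by simp
qed

lemma borel_measurable_vec_iff:
  fixes f :: "'a \<Rightarrow> 'b::euclidean_space^'n"
  shows "f \<in> borel_measurable M \<longleftrightarrow> (\<forall>k. (\<lambda>x. f x $ k) \<in> borel_measurable M)"
proof
  assume "\<forall>k. (\<lambda>x. f x $ k) \<in> borel_measurable M"
  then show "f \<in> borel_measurable M"
    by (subst borel_measurable_euclidean_space) (auto simp: Basis_vec_def inner_axis intro!: borel_measurable_inner)
next
  assume f: "f \<in> borel_measurable M"
  have "(\<lambda>x::'b^'n. x $ k) \<in> borel_measurable borel" for k
    by (intro borel_measurable_continuous_onI continuous_intros)
  with f show "\<forall>k. (\<lambda>x. f x $ k) \<in> borel_measurable M"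
    using measurable_compose by blast
qed

text \<open>Every coordinate of the product has law \<open>N\<close>. This computes the mean squared
  size of the random shift.\<close>

lemma nn_integral_PiM_sum:
  assumes "prob_space N" "finite I" and h: "h \<in> borel_measurable N"
  shows "(\<integral>\<^sup>+z. (\<Sum>i\<in>I. h (z i)) \<partial>(\<Pi>\<^sub>M i\<in>I. N)) = of_nat (card I) * (\<integral>\<^sup>+z. h z \<partial>N)"
proof -
  interpret N: prob_space N by fact
  interpret product_prob_space "\<lambda>_. N" I by unfold_locales
  have "(\<integral>\<^sup>+z. h (z i) \<partial>(\<Pi>\<^sub>M i\<in>I. N)) = (\<integral>\<^sup>+z. h z \<partial>N)" if "i \<in> I" for i
  proof -
    have "(\<integral>\<^sup>+z. h (z i) \<partial>(\<Pi>\<^sub>M i\<in>I. N)) = (\<integral>\<^sup>+z. h z \<partial>distr (\<Pi>\<^sub>M i\<in>I. N) N (\<lambda>z. z i))"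
      using that h by (subst nn_integral_distr) auto
    then show ?thesis by (simp add: PiM_component[OF that])
  qed
  moreover have "(\<lambda>z. h (z i)) \<in> borel_measurable (\<Pi>\<^sub>M i\<in>I. N)" if "i \<in> I" for i
    using that h by measurable
  ultimately show ?thesis by (simp add: nn_integral_sum)
qed

section \<open>The two-point argument\<close>

theorem theorem7p1:
  fixes X :: "(real^'d) set" and U :: "(real^'p) set"
    and \<mu> :: "(real^'d) measure" and \<nu> :: "(real^'p) measure"
    and \<Psi> :: "real^'d \<Rightarrow> complex^'n" and first :: 'n
    and B :: "complex^'p^'n"
    and \<sigma> \<Delta> \<kappa>0 g1 :: real and M :: nat
    and P :: "'w measure"
    and x :: "nat \<Rightarrow> 'w \<Rightarrow> real^'d" and u :: "nat \<Rightarrow> 'w \<Rightarrow> real^'p"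
    and e :: "nat \<Rightarrow> 'w \<Rightarrow> complex^'n"
  assumes mu: "prob_space \<mu>" "sets \<mu> = sets (restrict_space borel X)"
    and nu: "prob_space \<nu>" "sets \<nu> = sets (restrict_space borel U)"
    and Psi: "\<And>k. (\<lambda>z. \<Psi> z $ k) \<in> borel_measurable \<mu>"
      "\<And>k. integrable \<mu> (\<lambda>z. (cmod (\<Psi> z $ k))\<^sup>2)"
    and g1: "g1 = (\<integral>z. (cmod (\<Psi> z $ first))\<^sup>2 \<partial>\<mu>)"
    and params: "\<sigma> > 0" "\<Delta> > 0" "\<kappa>0 \<ge> 1"
    and P: "prob_space P"
    and design_iid:
      "prob_space.indep_vars P (\<lambda>_. \<mu> \<Otimes>\<^sub>M \<nu>) (\<lambda>i \<omega>. (x i \<omega>, u i \<omega>)) {1..M}"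
      "\<And>i. i \<in> {1..M} \<Longrightarrow> distr P (\<mu> \<Otimes>\<^sub>M \<nu>) (\<lambda>\<omega>. (x i \<omega>, u i \<omega>)) = \<mu> \<Otimes>\<^sub>M \<nu>"
    and noise_iid:
      "prob_space.indep_vars P (\<lambda>_. borel) e {1..M}"
      "\<And>i. i \<in> {1..M} \<Longrightarrow> distr P borel (e i) = complex_gaussian \<sigma>"
    and design_noise_indep:
      "prob_space.indep_set P
         {(\<lambda>\<omega>. \<lambda>i\<in>{1..M}. (x i \<omega>, u i \<omega>)) -` S \<inter> space P |S.
            S \<in> sets (\<Pi>\<^sub>M i\<in>{1..M}. \<mu> \<Otimes>\<^sub>M \<nu>)}
         {(\<lambda>\<omega>. \<lambda>i\<in>{1..M}. e i \<omega>) -` S \<inter> space P |S.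
            S \<in> sets (\<Pi>\<^sub>M i\<in>{1..M}. borel)}"
    and M: "\<sigma> / sqrt (2 * g1 * real M) \<le> \<Delta> / 2"
  shows "(INF Ahat \<in> estimators \<mu> \<nu> M. SUP A \<in> matrix_class \<Delta> \<kappa>0.
            \<integral>\<^sup>+ \<omega>. ennreal (eig_matching_dist (Ahat (observed_data \<Psi> B M x u e A \<omega>)) A) \<partial>P)
          \<ge> ennreal (\<sigma> / (8 * sqrt (g1 * real M)))"
proof (cases "g1 * real M = 0")
  case True
  \<comment> \<open>Here the claimed bound is \<open>\<sigma> / 0 = 0\<close>.\<close>
  show ?thesis unfolding True by simp
next
  case False
  interpret P: prob_space P by (rule P)
  interpret mu: prob_space \<mu> by (rule mu)
  interpret nu: prob_space \<nu> by (rule nu)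
  interpret munu: pair_prob_space \<mu> \<nu> ..
  have "g1 \<ge> 0" unfolding g1 by (intro integral_nonneg_AE) simp
  then have "g1 * real M \<ge> 0" by simp
  with False have gM: "g1 * real M > 0" by linarith
  then have "M > 0" by (cases M) auto
  let ?I = "{1..M}"
  have I: "?I \<noteq> {}" using \<open>M > 0\<close> by auto
  \<comment> \<open>The largest separation the hypothesis \<open>M\<close> keeps below \<Delta> / 2;
    it also normalises the mean of the squared shift, in units of \<sigma>, to 1 / 2
    (\<open>\<delta>sq\<close>).\<close>
  define \<delta> where "\<delta> = \<sigma> / sqrt (2 * g1 * real M)"
  have \<delta>: "\<delta> > 0" "\<delta> \<le> \<Delta> / 2" using params M gM by (auto simp: \<delta>_def mult.assoc)
  have "g1 > 0" using gM \<open>g1 \<ge> 0\<close> by (cases "g1 = 0") auto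
  then have \<delta>sq: "\<delta>\<^sup>2 / \<sigma>\<^sup>2 * (real M * g1) = 1 / 2"
    using \<open>M > 0\<close> params(1) by (simp add: \<delta>_def power_divide)

  \<comment> \<open>Two diagonal matrices in the class\<close>
  obtain idx :: "'n \<Rightarrow> nat" where idx: "inj idx" "idx first = 0"
  proof -
    obtain f :: "'n \<Rightarrow> nat" where f: "inj f" using finite_imp_inj_to_nat_seg[of "UNIV::'n set"] by auto
    show thesis
      by (rule that[of "\<lambda>j. if j = first then 0 else Suc (f j)"])
        (use f in \<open>auto simp: inj_def split: if_splits\<close>)
  qed
  \<comment> \<open>Gaps of 2 \<Delta> leave room to move one entry by \<delta> \<le> \<Delta> / 2
    and still have gaps of at least \<Delta>.\<close>
  define c :: "'n \<Rightarrow> real" where "c j = 2 * \<Delta> * idx j" for j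
  define c' where "c' = c(first := \<delta>)"
  have c_first: "c first = 0" by (simp add: c_def idx)
  have c_sep: "2 * \<Delta> \<le> \<bar>c j - c k\<bar>" if "j \<noteq> k" for j k
  proof -
    have "idx j \<noteq> idx k" using idx(1) that by (auto dest: injD)
    then have "1 \<le> \<bar>real (idx j) - real (idx k)\<bar>" by linarith
    then have "2 * \<Delta> * 1 \<le> 2 * \<Delta> * \<bar>real (idx j) - real (idx k)\<bar>"
      using params by (intro mult_left_mono) auto
    also have "\<dots> = \<bar>c j - c k\<bar>" using params by (simp add: c_def abs_mult flip: right_diff_distrib)
    finally show ?thesis by simp
  qed
  have c'_sep: "\<Delta> \<le> \<bar>c' j - c' k\<bar>" if "j \<noteq> k" for j k
    using c_sep[OF that] that \<delta> params c_first by (auto simp: c'_def abs_if split: if_splits)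
  have c'_far: "\<delta> \<le> \<bar>c' j - c first\<bar>" for j
    using c_sep[of j first] \<delta> params c_first by (auto simp: c'_def)
  define A0 :: "complex^'n^'n" where "A0 = (\<chi> i j. if i = j then of_real (c i) else 0)"
  define A1 :: "complex^'n^'n" where "A1 = (\<chi> i j. if i = j then of_real (c' i) else 0)"
  have cmod_diff: "cmod (of_real a - of_real b) = \<bar>a - b\<bar>" for a b
    by (metis norm_of_real of_real_diff)
  have A0: "A0 \<in> matrix_class \<Delta> \<kappa>0" unfolding A0_def
  proof (rule diagonal_in_matrix_class[OF params(2,3)])
    fix j k :: 'n assume "j \<noteq> k"
    then show "\<Delta> \<le> cmod (of_real (c j) - of_real (c k))"
      unfolding cmod_diff using c_sep[of j k] params by linarith
  qed
  have A1: "A1 \<in> matrix_class \<Delta> \<kappa>0" unfolding A1_def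
  proof (rule diagonal_in_matrix_class[OF params(2,3)])
    fix j k :: 'n assume "j \<noteq> k"
    then show "\<Delta> \<le> cmod (of_real (c' j) - of_real (c' k))" unfolding cmod_diff by (rule c'_sep)
  qed
  have two_point: "\<delta> \<le> eig_matching_dist A A0 + eig_matching_dist A A1" for A :: "complex^'n^'n"
    unfolding A0_def A1_def
    by (rule eig_matching_dist_diagonal_sum_ge[where i = first]) (simp only: cmod_diff c'_far)
  have A1_A0: "A1 *v y = A0 *v y + axis first (of_real \<delta> * y $ first)" for y :: "complex^'n"
    unfolding A0_def A1_def diagonal_matrix_vector_mult
    by (simp add: vec_eq_iff axis_def c'_def c_first)

  \<comment> \<open>Joint law of design and noise\<close>
  let ?D = "\<Pi>\<^sub>M i\<in>?I. \<mu> \<Otimes>\<^sub>M \<nu>"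
  let ?E = "\<Pi>\<^sub>M i\<in>?I. (borel :: (complex^'n) measure)"
  let ?G = "\<Pi>\<^sub>M i\<in>?I. (complex_gaussian \<sigma> :: (complex^'n) measure)"
  have law: "distr P (?D \<Otimes>\<^sub>M ?E) (\<lambda>\<omega>. (\<lambda>i\<in>?I. (x i \<omega>, u i \<omega>), \<lambda>i\<in>?I. e i \<omega>)) = ?D \<Otimes>\<^sub>M ?G"
    by (rule P.distr_pair_indep_families[OF I design_iid(1) _ noise_iid(1) _ design_noise_indep])
      (simp_all only: design_iid(2) noise_iid(2))
  have rv: "(\<lambda>\<omega>. (\<lambda>i\<in>?I. (x i \<omega>, u i \<omega>), \<lambda>i\<in>?I. e i \<omega>)) \<in> P \<rightarrow>\<^sub>M ?D \<Otimes>\<^sub>M ?E"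
  proof (rule measurable_Pair; rule measurable_restrict)
    fix i assume i: "i \<in> ?I"
    show "(\<lambda>\<omega>. (x i \<omega>, u i \<omega>)) \<in> P \<rightarrow>\<^sub>M \<mu> \<Otimes>\<^sub>M \<nu>"
      using conjunct1[OF design_iid(1)[unfolded P.indep_vars_def]] i by (rule bspec)
    show "e i \<in> P \<rightarrow>\<^sub>M borel"
      using conjunct1[OF noise_iid(1)[unfolded P.indep_vars_def]] i by (rule bspec)
  qed
  \<comment> \<open>Total mass 1 is inherited from the law of \<open>e 1\<close>, without evaluating
    the Gaussian integral.\<close>
  have gauss: "prob_space (complex_gaussian \<sigma> :: (complex^'n) measure)"
    using P.prob_space_distr[of "e 1" borel] noise_iid \<open>M > 0\<close> by (auto simp: P.indep_vars_def)
  interpret D: prob_space ?D by (intro prob_space_PiM munu.prob_space_axioms)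
  interpret G: prob_space ?G by (intro prob_space_PiM gauss)
  have setsG: "sets ?G = sets ?E" by (intro sets_PiM_cong) auto

  \<comment> \<open>The sample as a measurable function of design and noise\<close>
  have Psi_meas: "\<Psi> \<in> borel_measurable \<mu>" using Psi(1) by (simp add: borel_measurable_vec_iff)
  have cvec_meas: "cvec \<in> borel_measurable \<nu>"
  proof -
    have "(\<lambda>v. cvec v $ k) \<in> borel_measurable \<nu>" for k
      unfolding measurable_cong_sets[OF nu(2) refl] cvec_def
      by (simp, intro measurable_restrict_space1 borel_measurable_continuous_onI continuous_intros)
    then show ?thesis by (simp add: borel_measurable_vec_iff)
  qed
  have mat_meas: "(\<lambda>v. C *v v) \<in> borel_measurable borel" for C :: "complex^'k^'n"
    by (intro borel_measurable_continuous_onI matrix_vector_mult_linear_continuous_on)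

  define obs where "obs A d z = (\<lambda>i\<in>?I. (fst (d i), snd (d i),
      A *v \<Psi> (fst (d i)) + B *v cvec (snd (d i)) + z i))"
    for A d and z :: "nat \<Rightarrow> complex^'n"
  have obs_eq: "observed_data \<Psi> B M x u e A \<omega> = obs A (\<lambda>i\<in>?I. (x i \<omega>, u i \<omega>)) (\<lambda>i\<in>?I. e i \<omega>)"
    for A \<omega> by (auto simp: observed_data_def obs_def)
  have obs_meas: "(\<lambda>(d, z). obs A d z) \<in> ?D \<Otimes>\<^sub>M ?E \<rightarrow>\<^sub>M (\<Pi>\<^sub>M i\<in>?I. \<mu> \<Otimes>\<^sub>M (\<nu> \<Otimes>\<^sub>M borel))" for A
    unfolding obs_def split_beta'
  proof (rule measurable_restrict)
    fix i assume [measurable]: "i \<in> ?I"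
    note [measurable] = measurable_compose[OF Psi_meas mat_meas[of A]]
      measurable_compose[OF cvec_meas mat_meas[of B]]
    show "(\<lambda>w. (fst (fst w i), snd (fst w i), A *v \<Psi> (fst (fst w i)) + B *v cvec (snd (fst w i))
        + snd w i)) \<in> ?D \<Otimes>\<^sub>M ?E \<rightarrow>\<^sub>M \<mu> \<Otimes>\<^sub>M (\<nu> \<Otimes>\<^sub>M borel)"
      by measurable
  qed

  \<comment> \<open>The noise shift and its mean squared size\<close>
  define m where "m d i = axis first (of_real \<delta> * \<Psi> (fst (d i)) $ first)"
    for d :: "nat \<Rightarrow> (real^'d) \<times> (real^'p)" and i
  \<comment> \<open>For a fixed design, changing the matrix amounts to a translation of the noise,
    so both hypotheses are compared through one observation map.\<close>
  have obs_shift: "obs A1 d z = obs A0 d (\<lambda>i\<in>?I. z i + m d i)" for d z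
    by (auto simp: obs_def A1_A0 m_def algebra_simps)
  define s where "s d = (\<Sum>i\<in>?I. ennreal (\<delta> * (\<delta>\<^sup>2 / \<sigma>\<^sup>2 * (cmod (\<Psi> (fst (d i)) $ first))\<^sup>2)))"
    for d :: "nat \<Rightarrow> (real^'d) \<times> (real^'p)"
  have s_eq: "s d = ennreal (\<delta> * (\<Sum>i\<in>?I. (norm (m d i))\<^sup>2 / \<sigma>\<^sup>2))" for d
    unfolding s_def m_def norm_axis sum_distrib_left using \<delta>(1)
    by (subst sum_ennreal) (auto simp: norm_mult power_mult_distrib)
  have s_term: "(\<lambda>w. ennreal (\<delta> * (\<delta>\<^sup>2 / \<sigma>\<^sup>2 * (cmod (\<Psi> (fst w) $ first))\<^sup>2)))
      \<in> borel_measurable (\<mu> \<Otimes>\<^sub>M \<nu>)"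
    using Psi(1)[of first] by measurable
  have s_meas: "s \<in> borel_measurable ?D"
    unfolding s_def
  proof (rule borel_measurable_sum)
    fix i assume "i \<in> ?I"
    from measurable_component_singleton[OF this, of "\<lambda>_. \<mu> \<Otimes>\<^sub>M \<nu>"]
    show "(\<lambda>d. ennreal (\<delta> * (\<delta>\<^sup>2 / \<sigma>\<^sup>2 * (cmod (\<Psi> (fst (d i)) $ first))\<^sup>2)))
        \<in> borel_measurable ?D"
      using s_term by (rule measurable_compose)
  qed
  \<comment> \<open>Each of the \<open>M\<close> design points contributes the same mean,
    proportional to \<open>g1\<close>; the controls integrate out, and \<open>\<delta>sq\<close>
    evaluates the total.\<close>
  have s_int: "(\<integral>\<^sup>+d. s d \<partial>?D) = ennreal (\<delta> / 2)"
  proof -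
    have "(\<integral>\<^sup>+w. ennreal (\<delta> * (\<delta>\<^sup>2 / \<sigma>\<^sup>2 * (cmod (\<Psi> (fst w) $ first))\<^sup>2)) \<partial>(\<mu> \<Otimes>\<^sub>M \<nu>))
        = (\<integral>\<^sup>+w. ennreal (\<delta> * (\<delta>\<^sup>2 / \<sigma>\<^sup>2 * (cmod (\<Psi> w $ first))\<^sup>2)) \<partial>\<mu>)"
      using nu.nn_integral_fst[OF s_term] nu.emeasure_space_1 by simp
    also have "\<dots> = ennreal (\<integral>w. \<delta> * (\<delta>\<^sup>2 / \<sigma>\<^sup>2 * (cmod (\<Psi> w $ first))\<^sup>2) \<partial>\<mu>)"
      using Psi(2)[of first] \<delta> by (intro nn_integral_eq_integral) auto
    also have "\<dots> = ennreal (\<delta> * (\<delta>\<^sup>2 / \<sigma>\<^sup>2 * g1))" by (simp add: g1)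
    finally have "(\<integral>\<^sup>+d. s d \<partial>?D) = ennreal (real M) * ennreal (\<delta> * (\<delta>\<^sup>2 / \<sigma>\<^sup>2 * g1))"
      unfolding s_def
      by (subst nn_integral_PiM_sum[OF munu.prob_space_axioms _ s_term]) (auto simp: ennreal_of_nat_eq_real_of_nat)
    also have "\<dots> = ennreal (\<delta> * (\<delta>\<^sup>2 / \<sigma>\<^sup>2 * (real M * g1)))"
      by (simp add: ennreal_mult'[symmetric] mult_ac)
    finally show ?thesis unfolding \<delta>sq by simp
  qed

  \<comment> \<open>Risk of an arbitrary estimator\<close>
  show ?thesis
  proof (rule INF_greatest)
    fix Ahat :: "(nat \<Rightarrow> (real^'d) \<times> (real^'p) \<times> (complex^'n)) \<Rightarrow> complex^'n^'n"
    assume Ahat: "Ahat \<in> estimators \<mu> \<nu> M"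
    \<comment> \<open>The matrix \<open>A\<close> generating the data is kept apart from the target
      \<open>A'\<close>: the loss under \<open>A1\<close> is \<open>loss A0 A1\<close> at shifted
      noise.\<close>
    define loss where "loss A A' d z = ennreal (eig_matching_dist (Ahat (obs A d z)) A')" for A A' d z
    have loss_meas: "(\<lambda>(d, z). loss A A' d z) \<in> borel_measurable (?D \<Otimes>\<^sub>M ?E)" for A A'
    proof -
      have "(\<lambda>w. ennreal (eig_matching_dist (Ahat (case w of (d, z) \<Rightarrow> obs A d z)) A'))
          \<in> borel_measurable (?D \<Otimes>\<^sub>M ?E)"
        using measurable_compose[OF obs_meas Ahat[unfolded estimators_def]] by measurable
      then show ?thesis by (simp add: loss_def split_beta')
    qed
    define risk where
      "risk A = (\<integral>\<^sup>+\<omega>. ennreal (eig_matching_dist (Ahat (observed_data \<Psi> B M x u e A \<omega>)) A) \<partial>P)" for A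
    have sets_pair: "sets (?D \<Otimes>\<^sub>M ?G) = sets (?D \<Otimes>\<^sub>M ?E)" using setsG by (intro sets_pair_measure_cong) auto
    have loss_meas_G: "(\<lambda>(d, z). loss A A' d z) \<in> borel_measurable (?D \<Otimes>\<^sub>M ?G)" for A A'
      using loss_meas by (simp add: measurable_cong_sets[OF sets_pair refl])
    \<comment> \<open>Given the design the shift \<open>m d\<close> is deterministic, so the
      Gaussian bound applies for each \<open>d\<close> and is then integrated over the
      design.\<close>
    define cond_risk where "cond_risk A d = (\<integral>\<^sup>+z. loss A A d z \<partial>?G)" for A d
    have risk_eq: "risk A = (\<integral>\<^sup>+d. cond_risk A d \<partial>?D)" for A
    proof -
      have "risk A = (\<integral>\<^sup>+w. (case w of (d, z) \<Rightarrow> loss A A d z) \<partial>(?D \<Otimes>\<^sub>M ?G))"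
        unfolding law[symmetric] nn_integral_distr[OF rv loss_meas_G[of A A, folded law]] risk_def
        by (simp only: obs_eq loss_def prod.case)
      then show ?thesis using G.nn_integral_fst[OF loss_meas_G[of A A]] by (simp add: cond_risk_def)
    qed
    have [measurable]: "cond_risk A \<in> borel_measurable ?D" for A
      using G.borel_measurable_nn_integral_fst[OF loss_meas_G[of A A]]
      by (simp add: cond_risk_def[abs_def])
    have loss_z: "loss A A' d \<in> borel_measurable ?E" if "d \<in> space ?D" for A A' d
      using measurable_compose[OF measurable_Pair1'[OF that] loss_meas[of A A']] by simp
    have D_const: "(\<integral>\<^sup>+d. c \<partial>?D) = c" for c
      by (simp only: nn_integral_const D.emeasure_space_1 mult_1_right)
    note [measurable] = s_meas
    have "ennreal (4 * \<delta>) = (\<integral>\<^sup>+d. ennreal (4 * \<delta>) \<partial>?D)" by (simp only: D_const)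
    also have "\<dots> \<le> (\<integral>\<^sup>+d. 3 * (cond_risk A0 d + cond_risk A1 d) + ennreal (2 * \<delta>) + s d \<partial>?D)"
    proof (rule nn_integral_mono)
      fix d assume d: "d \<in> space ?D"
      have "loss A1 A1 d z = loss A0 A1 d (\<lambda>i\<in>?I. z i + m d i)" for z
        by (simp add: loss_def obs_shift)
      moreover have "ennreal \<delta> \<le> loss A0 A0 d z + loss A0 A1 d z" for z
        using two_point[of "Ahat (obs A0 d z)"]
        by (simp add: loss_def ennreal_leI eig_matching_dist_nonneg flip: ennreal_plus)
      ultimately show "ennreal (4 * \<delta>) \<le> 3 * (cond_risk A0 d + cond_risk A1 d)
          + ennreal (2 * \<delta>) + s d"
        using two_point_bound_gaussian[OF gauss _ loss_z[OF d, of A0 A0] loss_z[OF d, of A0 A1],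
            where m = "m d" and \<delta> = \<delta>] \<delta>(1) by (simp add: s_eq cond_risk_def)
    qed
    also have "\<dots> = 3 * (risk A0 + risk A1) + ennreal (2 * \<delta>) + ennreal (\<delta> / 2)"
      unfolding risk_eq
      by (simp add: nn_integral_add nn_integral_cmult s_int D_const del: nn_integral_const One_nat_def)
    finally have bound: "ennreal (4 * \<delta>) \<le> 3 * (risk A0 + risk A1) + ennreal (2 * \<delta>) + ennreal (\<delta> / 2)" .
    define S where "S = (SUP A \<in> matrix_class \<Delta> \<kappa>0. risk A)"
    have "risk A0 \<le> S" "risk A1 \<le> S" unfolding S_def using A0 A1 by (auto intro: SUP_upper)
    then have "3 * (risk A0 + risk A1) \<le> 3 * (S + S)" by (intro mult_left_mono add_mono) auto
    with bound have S_bound: "ennreal (4 * \<delta>) \<le> 3 * (S + S) + ennreal (2 * \<delta>) + ennreal (\<delta> / 2)"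
      by (meson add_right_mono order_trans)
    \<comment> \<open>An infinite \<open>S\<close> is trivial; a finite one allows the subtraction
      that turns 4 \<delta> \<le> 6 S + (5 / 2) \<delta> into the claim.\<close>
    have "ennreal (\<delta> / 4) \<le> S"
    proof (cases S)
      case (real r)
      have "3 * (S + S) + ennreal (2 * \<delta>) + ennreal (\<delta> / 2) = ennreal (3 * (r + r) + 2 * \<delta> + \<delta> / 2)"
      proof -
        have "3 * (S + S) = ennreal 3 * ennreal (r + r)"
          unfolding real(2) ennreal_plus[OF real(1) real(1)] by simp
        also have "\<dots> = ennreal (3 * (r + r))" using real(1) by (subst ennreal_mult) auto
        finally show ?thesis
          using real(1) \<delta>(1) by (simp only:) (subst ennreal_plus[symmetric]; simp)+
      qed
      with S_bound have "ennreal (4 * \<delta>) \<le> ennreal (3 * (r + r) + 2 * \<delta> + \<delta> / 2)" by simp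
      then have "4 * \<delta> \<le> 3 * (r + r) + 2 * \<delta> + \<delta> / 2"
        by (subst (asm) ennreal_le_iff) (use real(1) \<delta>(1) in auto)
      then have "\<delta> / 4 \<le> r" by simp
      then show ?thesis unfolding real(2) by (rule ennreal_leI)
    qed simp
    \<comment> \<open>The argument yields the denominator 4 sqrt 2; bounding sqrt 2 by 2 gives the
      stated constant 8.\<close>
    moreover have "\<sigma> / (8 * sqrt (g1 * real M)) \<le> \<delta> / 4"
    proof -
      have "sqrt (2 * g1 * real M) \<le> 2 * sqrt (g1 * real M)"
        using gM by (intro real_le_lsqrt) (auto simp: power_mult_distrib)
      then show ?thesis
        using gM params(1) by (simp add: \<delta>_def mult.assoc divide_simps)
    qed
    ultimately show "ennreal (\<sigma> / (8 * sqrt (g1 * real M))) \<le> (SUP A \<in> matrix_class \<Delta> \<kappa>0.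
        \<integral>\<^sup>+\<omega>. ennreal (eig_matching_dist (Ahat (observed_data \<Psi> B M x u e A \<omega>)) A) \<partial>P)"
      unfolding S_def risk_def by (meson ennreal_leI order_trans)
  qed
qed

end
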